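(* Let $\Gamma\subset\mathbb{R}^d$ be an acute closed convex solid cone, let $\mu$ be a positive measure of moderate growth on $\Gamma^*$, and let $S=\{p^{(j)}:1\le j\le N\}$ be a finite collection of points in $\operatorname{int}\Gamma$. The measure $\mu$ has finite support if and only if there exists a positive integer $n$ with the property $\operatorname{rank}(K_n)=\operatorname{rank}(K_{n+1})$.
   Context: Acute means containing no line; solid means with non-empty interior. $\Gamma^*=\{y\in\mathbb{R}^d: y\cdot x\ge 0\ \forall x\in\Gamma\}$. A nonnegative measure $\mu$ on $\Gamma^*$ is of moderate growth if $e^{-p\cdot x}\in L^1(\Gamma^*,\mu)$ for every $p\in\operatorname{int}\Gamma$. For $n\in\mathbb{N}_0$, let $\mathcal{M}_n=\operatorname{span}_{\mathbb{R}}\{x^\alpha e^{-p^{(j)}\cdot x}: \alpha\in\mathbb{N}_0^d,\ |\alpha|\le n,\ 1\le j\le N\}$, a finite-dimensional space of real continuous functions on $\Gamma^*$, and let $K_n$ be the positive semi-definite bilinear form on $\mathcal{M}_n$ given by $K_n(f,g)=\int_{\Gamma^*}f(x)g(x)\,d\mu(x)$. The rank of $K_n$ is the rank of its (Hankel) matrix $\Xi_n$, with entries $[\Xi_n]_{\alpha j,\beta k}=\int_{\Gamma^*}x^{\alpha+\beta}e^{-(p^{(j)}+p^{(k)})\cdot x}\,d\mu(x)$, $|\alpha|,|\beta|\le n$, $1\le j,k\le N$. *)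

theory Defs
  imports "HOL-Analysis.Analysis" "HOL-Library.Function_Algebras"
begin

definition contains_no_line :: "'a::real_vector set \<Rightarrow> bool" where
  "contains_no_line C \<longleftrightarrow> \<not> (\<exists>a v. v \<noteq> 0 \<and> (\<forall>t::real. a + t *\<^sub>R v \<in> C))"

definition dual_cone :: "'a::real_inner set \<Rightarrow> 'a set" where
  "dual_cone C = {y. \<forall>x\<in>C. 0 \<le> y \<bullet> x}"

text \<open>
  A nonnegative measure on the dual cone is a Borel measure whose underlying space is the
  dual cone itself, so integrals over the whole space are integrals over the dual cone.
\<close>

definition borel_measure_on :: "'a::topological_space set \<Rightarrow> 'a measure \<Rightarrow> bool" where
  "borel_measure_on D \<mu> \<longleftrightarrow> sets \<mu> = sets (restrict_space borel D)"

definition moderate_growth :: "'a::euclidean_space set \<Rightarrow> 'a measure \<Rightarrow> bool" where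
  "moderate_growth C \<mu> \<longleftrightarrow>
     (\<forall>p\<in>interior C. integrable \<mu> (\<lambda>x. exp (- (p \<bullet> x))))"

text \<open>The support, relative to the topology that the space of \<open>\<mu>\<close> inherits.\<close>

definition measure_support :: "'a::topological_space measure \<Rightarrow> 'a set" where
  "measure_support \<mu> =
     {x \<in> space \<mu>. \<forall>U. open U \<and> x \<in> U \<longrightarrow> emeasure \<mu> (U \<inter> space \<mu>) > 0}"

text \<open>
  Real-valued functions form a vector space under the pointwise operations; there is no
  \<open>real_vector\<close> instance for them, so span and dimension come from this interpretation.
\<close>

global_interpretation real_fun: vector_space "\<lambda>(c::real) (f::'i \<Rightarrow> real) x. c * f x"
  defines fun_span = real_fun.span and fun_dim = real_fun.dim
  by unfold_locales (auto simp: fun_eq_iff algebra_simps)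

definition mdegree :: "('d::finite \<Rightarrow> nat) \<Rightarrow> nat" where
  "mdegree \<alpha> = (\<Sum>i\<in>UNIV. \<alpha> i)"

definition mpower :: "real ^ 'd \<Rightarrow> ('d::finite \<Rightarrow> nat) \<Rightarrow> real" where
  "mpower x \<alpha> = (\<Prod>i\<in>UNIV. (x $ i) ^ \<alpha> i)"

text \<open>
  The points \<open>p\<^sup>(\<^sup>1\<^sup>), \<dots>, p\<^sup>(\<^sup>N\<^sup>)\<close> are \<open>p 1, \<dots>, p N\<close>; other values of \<open>p\<close> are never used.
  Elements of \<open>exp_poly_space\<close> are functions on the ambient space, which the form
  \<open>int_form\<close> sees only through their restrictions to the space of \<open>\<mu>\<close>.
\<close>

definition exp_monomial ::
    "(nat \<Rightarrow> real ^ 'd) \<Rightarrow> ('d::finite \<Rightarrow> nat) \<times> nat \<Rightarrow> real ^ 'd \<Rightarrow> real" where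
  "exp_monomial p = (\<lambda>(\<alpha>, j) x. mpower x \<alpha> * exp (- (p j \<bullet> x)))"

definition hankel_index :: "nat \<Rightarrow> nat \<Rightarrow> (('d::finite \<Rightarrow> nat) \<times> nat) set" where
  "hankel_index N n = {\<alpha>. mdegree \<alpha> \<le> n} \<times> {1..N}"

definition exp_poly_space ::
    "(nat \<Rightarrow> real ^ 'd) \<Rightarrow> nat \<Rightarrow> nat \<Rightarrow> (real ^ 'd::finite \<Rightarrow> real) set" where
  "exp_poly_space p N n = fun_span (exp_monomial p ` hankel_index N n)"

definition int_form :: "'a measure \<Rightarrow> ('a \<Rightarrow> real) \<Rightarrow> ('a \<Rightarrow> real) \<Rightarrow> real" where
  "int_form \<mu> f g = (\<integral>x. f x * g x \<partial>\<mu>)"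

definition hankel_entry ::
    "(real ^ 'd) measure \<Rightarrow> (nat \<Rightarrow> real ^ 'd) \<Rightarrow>
     ('d::finite \<Rightarrow> nat) \<times> nat \<Rightarrow> ('d \<Rightarrow> nat) \<times> nat \<Rightarrow> real" where
  "hankel_entry \<mu> p = (\<lambda>(\<alpha>, j) (\<beta>, k).
     (\<integral>x. mpower x (\<lambda>i. \<alpha> i + \<beta> i) * exp (- ((p j + p k) \<bullet> x)) \<partial>\<mu>))"

text \<open>
  Rank of a square matrix indexed by a finite set \<open>I\<close>: the dimension of the span of its rows,
  each row being extended by zero outside \<open>I\<close>.
\<close>

definition matrix_rank :: "'i set \<Rightarrow> ('i \<Rightarrow> 'i \<Rightarrow> real) \<Rightarrow> nat" where
  "matrix_rank I A = fun_dim ((\<lambda>i k. if k \<in> I then A i k else 0) ` I)"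

definition rank_K ::
    "(real ^ 'd::finite) measure \<Rightarrow> (nat \<Rightarrow> real ^ 'd) \<Rightarrow> nat \<Rightarrow> nat \<Rightarrow> nat" where
  "rank_K \<mu> p N n = matrix_rank (hankel_index N n) (hankel_entry \<mu> p)"

lemma finite_hankel_index: "finite (hankel_index N n :: (('d::finite \<Rightarrow> nat) \<times> nat) set)"
proof -
  have "{\<alpha> :: 'd \<Rightarrow> nat. mdegree \<alpha> \<le> n} \<subseteq> PiE UNIV (\<lambda>_. {..n})"
  proof
    fix \<alpha> :: "'d \<Rightarrow> nat" assume "\<alpha> \<in> {\<alpha>. mdegree \<alpha> \<le> n}"
    then have "\<alpha> i \<le> n" for i
      using member_le_sum[of i UNIV \<alpha>] by (simp add: mdegree_def)
    then show "\<alpha> \<in> PiE UNIV (\<lambda>_. {..n})" by (auto simp: PiE_def)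
  qed
  moreover have "finite (PiE (UNIV :: 'd set) (\<lambda>_. {..n}))"
    by (intro finite_PiE) auto
  ultimately show ?thesis
    unfolding hankel_index_def by (meson finite_SigmaI finite_atLeastAtMost finite_subset)
qed

text \<open>
  The Hankel matrix is the matrix of the form with respect to the spanning family of
  \<open>exp_poly_space\<close>, whose members lie in that space by definition.
\<close>

lemma exp_monomial_in_space:
  "a \<in> hankel_index N n \<Longrightarrow> exp_monomial p a \<in> exp_poly_space p N n"
  unfolding exp_poly_space_def by (intro real_fun.span_base imageI)

lemma hankel_entry_eq_int_form:
  "hankel_entry \<mu> p a b = int_form \<mu> (exp_monomial p a) (exp_monomial p b)"
  by (cases a; cases b)
    (simp add: hankel_entry_def int_form_def exp_monomial_def mpower_def power_add
      prod.distrib inner_add_left exp_add[symmetric] exp_diff exp_minus field_simps)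

end

theory Submission
  imports Defs
begin

text \<open>
  Consider the full infinite Gram matrix of the exponential monomials in \<open>L\<^sup>2(\<mu>)\<close>. Positivity of
  the form makes linear relations between finitely many of its rows the same as almost everywhere
  relations between the corresponding functions, and shows that \<open>rank K\<^sub>n\<close> is the dimension of
  the span \<open>V\<^sub>n\<close> of the rows of degree at most \<open>n\<close>. If \<open>rank K\<^sub>n = rank K\<^sub>n\<^sub>+\<^sub>1\<close>, then
  \<open>V\<^sub>n = V\<^sub>n\<^sub>+\<^sub>1\<close>, so \<open>V\<^sub>n\<close> is invariant under multiplication by each coordinate. Hence it
  contains all \<open>x\<^sub>i\<^sup>k exp (- p\<^sub>1 \<bullet> x)\<close>, and finite dimension yields a monic polynomial in
  \<open>x\<^sub>i\<close> vanishing almost everywhere, which confines the support to a finite grid.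
  Conversely, a measure carried by a finite set \<open>F\<close> bounds all the ranks by \<open>card F\<close>, and a bounded
  nondecreasing sequence of naturals cannot increase strictly forever.
\<close>

section \<open>Linear algebra: spans and dimensions of finite families\<close>

context vector_space
begin

text \<open>Coefficients are attached to indices rather than to vectors, so equal rows at distinct
  indices, as when \<open>p\<close> repeats a point, cause no trouble.\<close>

lemma in_span_image_iff:
  assumes "finite I"
  shows "v \<in> span (r ` I) \<longleftrightarrow> (\<exists>c. v = (\<Sum>i\<in>I. scale (c i) (r i)))"
proof
  assume "v \<in> span (r ` I)"
  with assms show "\<exists>c. v = (\<Sum>i\<in>I. scale (c i) (r i))"
  proof (induction I arbitrary: v rule: finite_induct)
    case empty
    then show ?case by simp
  next
    case (insert a I)
    from insert.prems obtain k where "v - scale k (r a) \<in> span (r ` I)"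
      by (auto simp: span_breakdown_eq)
    then obtain c where c: "v - scale k (r a) = (\<Sum>i\<in>I. scale (c i) (r i))"
      using insert.IH by blast
    have "(\<Sum>i\<in>I. scale ((c(a := k)) i) (r i)) = (\<Sum>i\<in>I. scale (c i) (r i))"
      using insert.hyps by (intro sum.cong) auto
    then have "v = (\<Sum>i\<in>insert a I. scale ((c(a := k)) i) (r i))"
      using insert.hyps c by (simp add: algebra_simps)
    then show ?case by blast
  qed
next
  assume "\<exists>c. v = (\<Sum>i\<in>I. scale (c i) (r i))"
  then show "v \<in> span (r ` I)"
    by (auto intro!: span_sum span_scale intro: span_base)
qed

lemma dim_mono_finite:
  assumes "S \<subseteq> T" "finite T"
  shows "dim S \<le> dim T"
proof -
  obtain B where B: "B \<subseteq> T" "independent B" "T \<subseteq> span B" "card B = dim T"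
    by (rule basis_exists)
  then have "S \<subseteq> span B" "finite B"
    using assms finite_subset by blast+
  then show ?thesis
    using dim_le_card[of S B] B(4) by simp
qed

text \<open>A basis of \<open>S\<close> extends inside \<open>T\<close> to a basis of
  \<open>T\<close>; the two have the same finite cardinality, so the extension adds nothing.\<close>

lemma span_eq_if_dim_eq_finite:
  assumes "S \<subseteq> T" "finite T" "dim S = dim T"
  shows "span S = span T"
proof -
  obtain B where B: "B \<subseteq> S" "independent B" "S \<subseteq> span B" "card B = dim S"
    by (rule basis_exists)
  obtain B' where B': "B \<subseteq> B'" "B' \<subseteq> T" "independent B'" "T \<subseteq> span B'"
    using maximal_independent_subset_extend[of B T] B assms(1) by blast
  have "card B' = dim T"
    using B' by (intro basis_card_eq_dim) auto
  then have "B = B'"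
    using B B' assms card_subset_eq[of B' B] finite_subset by metis
  then show ?thesis
    using B B' assms(1) span_mono span_span by (metis subset_antisym)
qed

text \<open>Otherwise every initial segment of \<open>v\<close> would be independent, and the one of
  length \<open>Suc (card T)\<close> would be too large for the span of \<open>T\<close>.\<close>

lemma ex_mem_span_previous:
  assumes "finite T" and "\<And>k. v k \<in> span T"
  shows "\<exists>m::nat. v m \<in> span (v ` {..<m})"
proof (rule ccontr)
  assume "\<not> ?thesis"
  then have *: "v m \<notin> span (v ` {..<m})" for m by blast
  have "independent (v ` {..<m}) \<and> card (v ` {..<m}) = m" for m
  proof (induction m)
    case (Suc m)
    have "v m \<notin> v ` {..<m}"
      using *[of m] span_base by metis
    moreover have "independent (insert (v m) (v ` {..<m}))"
      using *[of m] Suc by (intro independent_insertI) auto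
    ultimately show ?case using Suc by (simp add: lessThan_Suc)
  qed (simp add: independent_empty)
  then show False
    using independent_span_bound[OF assms(1), of "v ` {..<Suc (card T)}"] assms(2)
    by (auto simp: image_subset_iff)
qed

end

text \<open>Injectivity on the span carries a basis contained in \<open>S\<close> to a basis of the
  image, without changing its cardinality.\<close>

lemma (in vector_space_pair) dim_image_eq_if_inj_on_span:
  assumes "Vector_Spaces.linear s1 s2 f" and "inj_on f (vs1.span S)"
  shows "vs2.dim (f ` S) = vs1.dim S"
proof -
  interpret f: Vector_Spaces.linear s1 s2 f by fact
  obtain B where B: "B \<subseteq> S" "vs1.independent B" "S \<subseteq> vs1.span B" "card B = vs1.dim S"
    by (rule vs1.basis_exists)
  have inj: "inj_on f (vs1.span B)"
    using assms(2) B(1) by (meson inj_on_subset vs1.span_mono)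
  have "card (f ` B) = card B"
    using inj by (meson card_image inj_on_subset vs1.span_superset)
  moreover have "vs2.independent (f ` B)"
    using B(2) inj by (rule f.independent_injective_image)
  moreover have "f ` S \<subseteq> vs2.span (f ` B)"
    using B(3) by (auto simp: f.span_image)
  ultimately show ?thesis
    using B by (intro vs2.dim_unique[of "f ` B"]) auto
qed

section \<open>Gram matrices of square integrable families\<close>

lemma sum_fun_apply: "(\<Sum>i\<in>I. F i) x = (\<Sum>i\<in>I. F i x)"
  by (induction I rule: infinite_finite_induct) auto

locale square_integrable_family =
  fixes M :: "'a measure" and f :: "'i \<Rightarrow> 'a \<Rightarrow> real" and U :: "'i set"
  assumes meas: "a \<in> U \<Longrightarrow> f a \<in> borel_measurable M"
    and integrable_mult: "a \<in> U \<Longrightarrow> b \<in> U \<Longrightarrow> integrable M (\<lambda>x. f a x * f b x)"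
begin

text \<open>Columns range over all of \<open>U\<close>, not over a finite truncation, so that the
  rows of Gram matrices of different sizes lie in one common space and their spans can be
  compared.\<close>

definition row :: "'i \<Rightarrow> 'i \<Rightarrow> real" where
  "row a = (\<lambda>k. if k \<in> U then \<integral>x. f a x * f k x \<partial>M else 0)"

lemma integral_combination:
  assumes "I \<subseteq> U" "k \<in> U"
  shows "(\<Sum>a\<in>I. c a * row a k) = (\<integral>x. (\<Sum>a\<in>I. c a * f a x) * f k x \<partial>M)"
    and "integrable M (\<lambda>x. (\<Sum>a\<in>I. c a * f a x) * f k x)"
proof -
  have eq: "(\<lambda>x. (\<Sum>a\<in>I. c a * f a x) * f k x) = (\<lambda>x. \<Sum>a\<in>I. c a * (f a x * f k x))"
    by (simp add: sum_distrib_right mult.assoc)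
  have "integrable M (\<lambda>x. c a * (f a x * f k x))" if "a \<in> I" for a
    using integrable_mult[of a k] assms that by auto
  then show "integrable M (\<lambda>x. (\<Sum>a\<in>I. c a * f a x) * f k x)"
    and "(\<Sum>a\<in>I. c a * row a k) = (\<integral>x. (\<Sum>a\<in>I. c a * f a x) * f k x \<partial>M)"
    unfolding eq by (auto simp: row_def assms)
qed

text \<open>If \<open>g = \<Sum>c a * f a\<close> is orthogonal to every \<open>f k\<close> with \<open>k \<in> I\<close>, it is orthogonal to itself.\<close>

lemma AE_zero_if_rows_zero:
  assumes "finite I" "I \<subseteq> U" and "\<And>k. k \<in> I \<Longrightarrow> (\<Sum>a\<in>I. c a * row a k) = 0"
  shows "AE x in M. (\<Sum>a\<in>I. c a * f a x) = 0"
proof -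
  let ?g = "\<lambda>x. \<Sum>a\<in>I. c a * f a x"
  have eq: "(\<lambda>x. ?g x * ?g x) = (\<lambda>x. \<Sum>k\<in>I. c k * (?g x * f k x))"
    by (simp add: sum_distrib_left mult_ac)
  have i: "integrable M (\<lambda>x. c k * (?g x * f k x))" if "k \<in> I" for k
    using integral_combination(2)[OF assms(2), of k c] that assms(2) by auto
  have "(\<integral>x. ?g x * ?g x \<partial>M) = (\<Sum>k\<in>I. c k * (\<integral>x. ?g x * f k x \<partial>M))"
    unfolding eq using i by (subst Bochner_Integration.integral_sum) auto
  also have "\<dots> = 0"
    using assms integral_combination(1)[OF assms(2), of _ c]
    by (intro sum.neutral) (auto simp: subset_iff)
  finally have "(\<integral>x. ?g x * ?g x \<partial>M) = 0" .
  moreover have "integrable M (\<lambda>x. ?g x * ?g x)"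
    unfolding eq using i by auto
  ultimately show ?thesis
    by (simp add: integral_nonneg_eq_0_iff_AE)
qed

text \<open>Here \<open>k\<close> is arbitrary. Together with \<open>AE_zero_if_rows_zero\<close>, a
  combination of rows from \<open>I\<close> that vanishes on the columns in \<open>I\<close>
  vanishes on every column.\<close>

lemma rows_zero_if_AE_zero:
  assumes "I \<subseteq> U" and "AE x in M. (\<Sum>a\<in>I. c a * f a x) = 0"
  shows "(\<Sum>a\<in>I. c a * row a k) = 0"
proof (cases "k \<in> U")
  case True
  have "(\<integral>x. (\<Sum>a\<in>I. c a * f a x) * f k x \<partial>M) = 0"
    using assms(2) by (intro integral_eq_zero_AE) auto
  with integral_combination(1)[OF assms(1) True] show ?thesis by simp
qed (simp add: row_def)

text \<open>Moving row \<open>b\<close> to the other side turns both conditions into vanishing of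
  one combination over \<open>insert b I\<close>, where the two preceding lemmas apply.\<close>

lemma row_in_span_iff:
  assumes "finite I" "I \<subseteq> U" "b \<in> U"
  shows "row b \<in> fun_span (row ` I) \<longleftrightarrow> (\<exists>c. AE x in M. f b x = (\<Sum>a\<in>I. c a * f a x))"
proof (cases "b \<in> I")
  case True
  have "(\<Sum>a\<in>I. (if a = b then 1 else 0) * f a x) = f b x" for x
    using True assms(1) by (simp add: if_distrib[of "\<lambda>c. c * _"] cong: if_cong)
  then have "\<exists>c. AE x in M. f b x = (\<Sum>a\<in>I. c a * f a x)"
    by (intro exI[of _ "\<lambda>a. if a = b then 1 else 0"] AE_I2) simp
  then show ?thesis
    using True by (auto intro: real_fun.span_base)
next
  case False
  \<comment> \<open>The coefficient -1 at the new index \<open>b\<close> encodes the difference; the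
    update leaves the sum over \<open>I\<close> alone only because \<open>b\<close> lies outside
    \<open>I\<close>.\<close>
  have sum_eq: "(\<Sum>a\<in>insert b I. (c(b := - 1)) a * g a) = (\<Sum>a\<in>I. c a * g a) - g b"
    for c and g :: "'i \<Rightarrow> real"
  proof -
    have "(\<Sum>a\<in>I. (c(b := - 1)) a * g a) = (\<Sum>a\<in>I. c a * g a)"
      using False by (intro sum.cong) auto
    then show ?thesis using False assms(1) by simp
  qed
  have sub: "insert b I \<subseteq> U" using assms by auto
  have "row b = (\<Sum>a\<in>I. (\<lambda>k. c a * row a k)) \<longleftrightarrow> (AE x in M. f b x = (\<Sum>a\<in>I. c a * f a x))"
    (is "?L \<longleftrightarrow> ?R") for c
  proof
    assume eq: ?L
    have "row b k = (\<Sum>a\<in>I. c a * row a k)" for k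
      using fun_cong[OF eq, of k] by (simp only: sum_fun_apply)
    then have "(\<Sum>a\<in>insert b I. (c(b := - 1)) a * row a k) = 0" for k
      unfolding sum_eq by simp
    then have "AE x in M. (\<Sum>a\<in>insert b I. (c(b := - 1)) a * f a x) = 0"
      using assms sub by (intro AE_zero_if_rows_zero) auto
    then show ?R unfolding sum_eq by eventually_elim simp
  next
    assume ?R
    then have "AE x in M. (\<Sum>a\<in>insert b I. (c(b := - 1)) a * f a x) = 0"
      unfolding sum_eq by eventually_elim simp
    then have "(\<Sum>a\<in>insert b I. (c(b := - 1)) a * row a k) = 0" for k
      by (rule rows_zero_if_AE_zero[OF sub])
    then show ?L unfolding sum_eq by (auto simp: fun_eq_iff sum_fun_apply)
  qed
  then show ?thesis
    by (simp add: real_fun.in_span_image_iff[OF assms(1)])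
qed

text \<open>Truncating the rows to the columns in \<open>I\<close> loses no dimension: by
  positivity, an element of their span that vanishes on those columns is zero, so truncation is
  injective there.\<close>

lemma matrix_rank_gram:
  assumes "finite I" "I \<subseteq> U"
  shows "matrix_rank I (\<lambda>a b. \<integral>x. f a x * f b x \<partial>M) = fun_dim (row ` I)"
proof -
  define restr where "restr v = (\<lambda>k. if k \<in> I then v k else 0)" for v :: "'i \<Rightarrow> real"
  interpret pair: vector_space_pair
    "\<lambda>(c::real) (g::'i \<Rightarrow> real) x. c * g x" "\<lambda>(c::real) (g::'i \<Rightarrow> real) x. c * g x"
    by unfold_locales
  have lin: "Vector_Spaces.linear (\<lambda>c g x. c * g x) (\<lambda>c g x. c * g x) restr"
    by unfold_locales (auto simp: restr_def fun_eq_iff)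
  have "v = 0" if v: "v \<in> fun_span (row ` I)" and 0: "restr v = 0" for v
  proof -
    obtain c where c: "v = (\<Sum>a\<in>I. (\<lambda>k. c a * row a k))"
      using v real_fun.in_span_image_iff[OF assms(1)] by auto
    have "(\<Sum>a\<in>I. c a * row a k) = 0" if "k \<in> I" for k
      using fun_cong[OF 0, of k] that by (simp add: restr_def c sum_fun_apply)
    then have "AE x in M. (\<Sum>a\<in>I. c a * f a x) = 0"
      using assms by (intro AE_zero_if_rows_zero)
    then show ?thesis
      using rows_zero_if_AE_zero[OF assms(2)] by (auto simp: c fun_eq_iff sum_fun_apply)
  qed
  then have "inj_on restr (fun_span (row ` I))"
    using module_hom.inj_on_iff_eq_0[OF lin[unfolded linear_iff_module_hom]] by auto
  then have "fun_dim (restr ` row ` I) = fun_dim (row ` I)"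
    using pair.dim_image_eq_if_inj_on_span[OF lin] unfolding fun_dim_def fun_span_def by blast
  moreover have "restr ` row ` I = (\<lambda>a k. if k \<in> I then \<integral>x. f a x * f k x \<partial>M else 0) ` I"
    using assms(2) by (auto simp: restr_def row_def image_image fun_eq_iff intro!: image_cong)
  ultimately show ?thesis by (simp add: matrix_rank_def)
qed

end

section \<open>Monomials and growth bounds on the dual cone\<close>

lemma mpower_fun_upd_Suc: "mpower x (\<alpha>(i := Suc (\<alpha> i))) = x $ i * mpower x \<alpha>"
proof -
  have "(\<Prod>j\<in>UNIV - {i}. (x $ j) ^ (\<alpha>(i := Suc (\<alpha> i))) j) = (\<Prod>j\<in>UNIV - {i}. (x $ j) ^ \<alpha> j)"
    by (rule prod.cong) auto
  then show ?thesis
    unfolding mpower_def by (simp add: prod.remove[of UNIV i])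
qed

lemma mdegree_fun_upd_Suc: "mdegree (\<alpha>(i := Suc (\<alpha> i))) = Suc (mdegree \<alpha>)"
proof -
  have "(\<Sum>j\<in>UNIV - {i}. (\<alpha>(i := Suc (\<alpha> i))) j) = (\<Sum>j\<in>UNIV - {i}. \<alpha> j)"
    by (rule sum.cong) auto
  then show ?thesis
    unfolding mdegree_def by (simp add: sum.remove[of UNIV i])
qed

lemma mpower_add: "mpower x (\<lambda>i. \<alpha> i + \<beta> i) = mpower x \<alpha> * mpower x \<beta>"
  by (simp add: mpower_def power_add prod.distrib)

lemma abs_mpower_le: "\<bar>mpower x \<alpha>\<bar> \<le> norm x ^ mdegree \<alpha>"
proof -
  have "\<bar>mpower x \<alpha>\<bar> = (\<Prod>i\<in>UNIV. \<bar>x $ i\<bar> ^ \<alpha> i)"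
    by (simp add: mpower_def abs_prod power_abs)
  also have "\<dots> \<le> (\<Prod>i\<in>UNIV. norm x ^ \<alpha> i)"
    by (intro prod_mono) (auto intro!: power_mono component_le_norm_cart)
  finally show ?thesis by (simp add: mdegree_def power_sum)
qed

lemma borel_measurable_exp_monomial [measurable]: "exp_monomial p a \<in> borel_measurable borel"
proof -
  obtain \<alpha> j where "a = (\<alpha>, j)" by (cases a)
  then show ?thesis
    unfolding exp_monomial_def mpower_def
    by (auto intro!: borel_measurable_continuous_onI continuous_intros)
qed

text \<open>A ball of radius \<open>e\<close> around \<open>p\<close> lies in \<open>C\<close>;
  testing \<open>y\<close> against the point of that ball furthest in direction \<open>- y\<close>
  gives the bound with \<open>e\<close> as the constant.\<close>

lemma dual_cone_coercive:
  assumes "p \<in> interior C"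
  obtains \<delta> where "\<delta> > 0" "\<And>y. y \<in> dual_cone C \<Longrightarrow> \<delta> * norm y \<le> p \<bullet> y"
proof -
  obtain e where e: "e > 0" "cball p e \<subseteq> C"
    using assms by (meson mem_interior_cball)
  have "e * norm y \<le> p \<bullet> y" if y: "y \<in> dual_cone C" for y
  proof -
    \<comment> \<open>\<open>sgn y\<close> is \<open>y\<close> divided by its norm, and 0 for
      \<open>y = 0\<close>, so the point stays within distance \<open>e\<close> of \<open>p\<close>
      in every case.\<close>
    have "p - e *\<^sub>R sgn y \<in> C"
      using e by (intro subsetD[OF e(2)]) (simp add: dist_norm norm_sgn)
    then have "0 \<le> y \<bullet> (p - e *\<^sub>R sgn y)"
      using y by (simp add: dual_cone_def)
    moreover have "y \<bullet> sgn y = norm y"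
      by (cases "y = 0") (simp_all add: sgn_div_norm dot_square_norm power2_eq_square)
    ultimately show ?thesis
      by (simp add: inner_diff_right inner_commute)
  qed
  with e(1) that show ?thesis by blast
qed

lemma power_le_exp:
  fixes \<delta> :: real
  assumes "\<delta> > 0"
  obtains K where "\<And>t. 0 \<le> t \<Longrightarrow> t ^ m \<le> K * exp (\<delta> * t)"
proof
  fix t :: real assume t: "0 \<le> t"
  \<comment> \<open>Dividing by \<open>Suc m\<close> instead of \<open>m\<close> keeps
    \<open>a\<close> well defined and positive for \<open>m = 0\<close>, while still
    \<open>m * a \<le> \<delta>\<close>.\<close>
  define a where "a = \<delta> / Suc m"
  have a: "a > 0" using assms by (simp add: a_def)
  have "a * t \<le> exp (a * t)"
    using exp_ge_add_one_self[of "a * t"] by linarith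
  then have "(a * t) ^ m \<le> exp (a * t) ^ m"
    using a t by (intro power_mono) auto
  also have "\<dots> = exp (real m * (a * t))"
    by (simp add: exp_of_nat_mult)
  also have "\<dots> \<le> exp (\<delta> * t)"
  proof -
    have "real m * a \<le> \<delta>" using assms by (simp add: a_def field_simps)
    then show ?thesis using t by (simp add: mult.assoc[symmetric] mult_right_mono)
  qed
  finally show "t ^ m \<le> (1 / a) ^ m * exp (\<delta> * t)"
    using a by (simp add: power_mult_distrib power_divide field_simps)
qed

section \<open>Borel measures on a subset and their supports\<close>

lemma
  assumes "borel_measure_on D \<mu>"
  shows borel_measure_on_space: "space \<mu> = D"
    and borel_measure_on_measurable: "f \<in> borel_measurable borel \<Longrightarrow> f \<in> borel_measurable \<mu>"
    and borel_measure_on_sets: "A \<in> sets borel \<Longrightarrow> A \<inter> D \<in> sets \<mu>"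
proof -
  have s: "sets \<mu> = sets (restrict_space borel D)"
    using assms by (simp add: borel_measure_on_def)
  show "space \<mu> = D"
    using sets_eq_imp_space_eq[OF s] by (simp add: space_restrict_space)
  show "f \<in> borel_measurable \<mu>" if "f \<in> borel_measurable borel"
    using measurable_restrict_space1[OF that, of D] by (simp add: measurable_cong_sets[OF s refl])
  show "A \<inter> D \<in> sets \<mu>" if "A \<in> sets borel"
    using that by (auto simp: s sets_restrict_space)
qed

text \<open>Outside the support, every point of the space has an open null neighbourhood; by
  Lindelof, countably many of these null sets cover all such points.\<close>

lemma AE_in_measure_support:
  fixes \<mu> :: "'a::second_countable_topology measure"
  assumes "borel_measure_on D \<mu>"
  shows "AE x in \<mu>. x \<in> measure_support \<mu>"
proof -
  let ?F = "{U. open U \<and> emeasure \<mu> (U \<inter> space \<mu>) = 0}"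
  obtain F' where F': "F' \<subseteq> ?F" "countable F'" "\<Union>F' = \<Union>?F"
    using Lindelof[of ?F] by blast
  have "AE x in \<mu>. x \<notin> U" if "U \<in> F'" for U
  proof -
    have "open U" "emeasure \<mu> (U \<inter> space \<mu>) = 0" using F'(1) that by auto
    moreover have "U \<inter> space \<mu> \<in> sets \<mu>"
      using borel_measure_on_sets[OF assms] borel_measure_on_space[OF assms] \<open>open U\<close> by simp
    ultimately have "AE x in \<mu>. x \<notin> U \<inter> space \<mu>"
      by (intro AE_not_in null_setsI)
    then show ?thesis by (rule AE_mp) auto
  qed
  then have "AE x in \<mu>. \<forall>U\<in>F'. x \<notin> U"
    using F'(2) by (simp add: AE_ball_countable)
  then show ?thesis
  proof (rule AE_mp, intro AE_I2 impI)
    fix x assume x: "x \<in> space \<mu>" and "\<forall>U\<in>F'. x \<notin> U"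
    then have "x \<notin> \<Union>?F" using F'(3) by blast
    then show "x \<in> measure_support \<mu>"
      using x by (auto simp: measure_support_def zero_less_iff_neq_zero)
  qed
qed

text \<open>The complement of \<open>F\<close> is an open null set, hence contains no support
  point.\<close>

lemma measure_support_subset_closed:
  assumes "borel_measure_on D \<mu>" "closed F" "AE x in \<mu>. x \<in> F"
  shows "measure_support \<mu> \<subseteq> F"
proof
  fix x assume x: "x \<in> measure_support \<mu>"
  have "emeasure \<mu> (- F \<inter> space \<mu>) = 0"
  proof (rule AE_iff_measurable[THEN iffD1, OF _ _ assms(3)])
    show "- F \<inter> space \<mu> \<in> sets \<mu>"
      using borel_measure_on_sets[OF assms(1), of "- F"] borel_measure_on_space[OF assms(1)] assms(2)
      by auto
  qed auto
  moreover have "open (- F)" using assms(2) by auto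
  ultimately show "x \<in> F"
    using x unfolding measure_support_def by (metis (no_types, lifting) ComplI mem_Collect_eq less_irrefl)
qed

section \<open>Gram rows and ranks for a measure of moderate growth\<close>

locale moderate_growth_measure =
  fixes \<Gamma> :: "(real ^ 'd::finite) set" and \<mu> :: "(real ^ 'd) measure"
    and p :: "nat \<Rightarrow> real ^ 'd" and N :: nat
  assumes borel: "borel_measure_on (dual_cone \<Gamma>) \<mu>"
    and growth: "moderate_growth \<Gamma> \<mu>"
    and points: "\<forall>j\<in>{1..N}. p j \<in> interior \<Gamma>"
    and N_pos: "N \<ge> 1"
begin

text \<open>The exponential at \<open>p k\<close> absorbs the polynomial factor by coercivity, and
  the one at \<open>p j\<close> remains as a majorant, integrable by moderate growth.\<close>

lemma integrable_exp_monomial_mult: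
  assumes "a \<in> UNIV \<times> {1..N}" "b \<in> UNIV \<times> {1..N}"
  shows "integrable \<mu> (\<lambda>x. exp_monomial p a x * exp_monomial p b x)"
proof -
  obtain \<alpha> j \<beta> k where ab: "a = (\<alpha>, j)" "b = (\<beta>, k)" and jk: "j \<in> {1..N}" "k \<in> {1..N}"
    using assms by auto
  obtain \<delta> where \<delta>: "\<delta> > 0" "\<And>y. y \<in> dual_cone \<Gamma> \<Longrightarrow> \<delta> * norm y \<le> p k \<bullet> y"
    using dual_cone_coercive points jk by blast
  define \<gamma> where "\<gamma> = (\<lambda>i. \<alpha> i + \<beta> i)"
  obtain K where K: "\<And>t. 0 \<le> t \<Longrightarrow> t ^ mdegree \<gamma> \<le> K * exp (\<delta> * t)"
    using power_le_exp[OF \<delta>(1)] by blast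
  \<comment> \<open>At \<open>t = 0\<close> the power is 1 for degree 0, since
    \<open>0 ^ 0 = 1\<close>, and 0 otherwise; either way it is a nonnegative lower bound for
    \<open>K\<close>.\<close>
  have K0: "K \<ge> 0" using K[of 0] by (cases "mdegree \<gamma>") auto
  have bound: "\<bar>exp_monomial p a x * exp_monomial p b x\<bar> \<le> K * exp (- (p j \<bullet> x))"
    if x: "x \<in> dual_cone \<Gamma>" for x
  proof -
    have "\<bar>mpower x \<gamma>\<bar> \<le> K * exp (\<delta> * norm x)"
      using abs_mpower_le[of x \<gamma>] K[of "norm x"] by simp
    also have "\<dots> \<le> K * exp (p k \<bullet> x)"
      using \<delta>(2)[OF x] K0 by (intro mult_left_mono) auto
    finally have "\<bar>mpower x \<gamma>\<bar> * exp (- (p k \<bullet> x)) \<le> K * exp (p k \<bullet> x) * exp (- (p k \<bullet> x))"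
      by (intro mult_right_mono) auto
    then have "\<bar>mpower x \<gamma>\<bar> * exp (- (p k \<bullet> x)) \<le> K"
      by (simp add: mult.assoc flip: exp_add)
    then have "\<bar>mpower x \<gamma>\<bar> * exp (- (p k \<bullet> x)) * exp (- (p j \<bullet> x)) \<le> K * exp (- (p j \<bullet> x))"
      by (intro mult_right_mono) auto
    then show ?thesis
      by (simp add: ab exp_monomial_def \<gamma>_def mpower_add abs_mult mult_ac)
  qed
  have [measurable]: "exp_monomial p a \<in> borel_measurable \<mu>" "exp_monomial p b \<in> borel_measurable \<mu>"
    by (auto intro: borel_measure_on_measurable[OF borel])
  have "integrable \<mu> (\<lambda>x. K * exp (- (p j \<bullet> x)))"
    using growth points jk by (auto simp: moderate_growth_def)
  then show ?thesis
  proof (rule Bochner_Integration.integrable_bound)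
    show "AE x in \<mu>. norm (exp_monomial p a x * exp_monomial p b x) \<le> norm (K * exp (- (p j \<bullet> x)))"
      using bound K0 borel_measure_on_space[OF borel] by (intro AE_I2) (auto simp: abs_mult)
  qed measurable
qed

sublocale square_integrable_family \<mu> "exp_monomial p" "UNIV \<times> {1..N}"
  by unfold_locales
    (auto intro: borel_measure_on_measurable[OF borel] integrable_exp_monomial_mult)

lemma hankel_index_subset: "hankel_index N n \<subseteq> UNIV \<times> {1..N}"
  by (auto simp: hankel_index_def)

lemma hankel_index_mono: "m \<le> n \<Longrightarrow> hankel_index N m \<subseteq> hankel_index N n"
  by (auto simp: hankel_index_def)

text \<open>The ranks of growing matrices thereby become dimensions of an increasing chain of
  subspaces of a single space.\<close>

lemma rank_K_eq_dim_rows: "rank_K \<mu> p N n = fun_dim (row ` hankel_index N n)"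
proof -
  have "hankel_entry \<mu> p = (\<lambda>a b. \<integral>x. exp_monomial p a x * exp_monomial p b x \<partial>\<mu>)"
    by (intro ext) (simp add: hankel_entry_eq_int_form int_form_def)
  then show ?thesis
    by (simp add: rank_K_def matrix_rank_gram[OF finite_hankel_index hankel_index_subset])
qed

lemma rank_K_mono: "m \<le> n \<Longrightarrow> rank_K \<mu> p N m \<le> rank_K \<mu> p N n"
  unfolding rank_K_eq_dim_rows
  by (intro real_fun.dim_mono_finite image_mono hankel_index_mono finite_imageI finite_hankel_index)

section \<open>Finite support forces the ranks to stabilise\<close>

text \<open>Integration against the measure is a finite sum over its atoms, so each row is a
  combination of the evaluation vectors \<open>ev x\<close>, one for each support point.\<close>

lemma rank_K_le_card_support:
  assumes fin: "finite (measure_support \<mu>)"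
  shows "rank_K \<mu> p N n \<le> card (measure_support \<mu>)"
proof -
  let ?F = "measure_support \<mu>" and ?U = "UNIV \<times> {1..N} :: (('d \<Rightarrow> nat) \<times> nat) set"
  define ev where "ev x = (\<lambda>k. if k \<in> ?U then exp_monomial p k x else 0)" for x
  have sub: "?F \<subseteq> space \<mu>" by (auto simp: measure_support_def)
  have sing: "{x} \<in> sets \<mu>" if "x \<in> ?F" for x
    using borel_measure_on_sets[OF borel, of "{x}"] borel_measure_on_space[OF borel] that sub by auto
  \<comment> \<open>The weight \<open>exp (- (p 1 \<bullet> y))\<close> is integrable and positive
    at \<open>x\<close>, so dividing by its value there bounds the mass of the atom.\<close>
  have finite_mass: "emeasure \<mu> {x} < \<infinity>" if x: "x \<in> ?F" for x
  proof -
    let ?e = "\<lambda>y. exp (- (p 1 \<bullet> y))"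
    have "integrable \<mu> ?e"
      using growth points N_pos by (auto simp: moderate_growth_def)
    then have "integrable \<mu> (\<lambda>y. ?e y * indicator {x} y)"
      using sing[OF x] by (rule integrable_real_mult_indicator[rotated])
    then have "integrable \<mu> (\<lambda>y. ?e y * indicator {x} y / ?e x)"
      by simp
    also have "(\<lambda>y. ?e y * indicator {x} y / ?e x) = (indicator {x} :: _ \<Rightarrow> real)"
      by (auto simp: fun_eq_iff indicator_def)
    finally show ?thesis
      using x sub by (auto simp: integrable_indicator_iff Int_absorb2)
  qed
  have "row a \<in> fun_span (ev ` ?F)" if "a \<in> ?U" for a
  proof -
    have "row a k = (\<Sum>x\<in>?F. (exp_monomial p a x * measure \<mu> {x}) * ev x k)" for k
    proof (cases "k \<in> ?U")
      case True
      let ?g = "\<lambda>x. exp_monomial p a x * exp_monomial p k x"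
      have [measurable]: "?F \<in> sets \<mu>"
        using sets.finite_UN[of ?F "\<lambda>x. {x}" \<mu>] fin sing by simp
      have [measurable]: "exp_monomial p a \<in> borel_measurable \<mu>" "exp_monomial p k \<in> borel_measurable \<mu>"
        by (auto intro: borel_measure_on_measurable[OF borel])
      have "(\<integral>x. ?g x \<partial>\<mu>) = (\<integral>x. ?g x * indicator ?F x \<partial>\<mu>)"
        using AE_in_measure_support[OF borel] by (intro integral_cong_AE) auto
      also have "\<dots> = (\<Sum>x\<in>?F. ?g x * measure \<mu> {x})"
        using sing finite_mass by (intro integral_indicator_finite_real fin) auto
      finally show ?thesis using True by (simp add: row_def ev_def mult_ac del: One_nat_def)
    qed (simp add: row_def ev_def del: One_nat_def)
    then have "row a = (\<Sum>x\<in>?F. (\<lambda>k. (exp_monomial p a x * measure \<mu> {x}) * ev x k))"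
      by (simp add: fun_eq_iff sum_fun_apply)
    then show ?thesis
      unfolding real_fun.in_span_image_iff[OF fin]
      by (intro exI[of _ "\<lambda>x. exp_monomial p a x * measure \<mu> {x}"])
  qed
  then have "row ` hankel_index N n \<subseteq> fun_span (ev ` ?F)"
    using hankel_index_subset by blast
  then have "rank_K \<mu> p N n \<le> card (ev ` ?F)"
    unfolding rank_K_eq_dim_rows
    using fin by (intro real_fun.dim_le_card) auto
  also have "\<dots> \<le> card ?F" by (rule card_image_le[OF fin])
  finally show ?thesis .
qed

lemma rank_K_stabilises:
  assumes "finite (measure_support \<mu>)"
  shows "\<exists>n\<ge>1. rank_K \<mu> p N n = rank_K \<mu> p N (n + 1)"
proof (rule ccontr)
  assume contra: "\<not> ?thesis"
  have less: "rank_K \<mu> p N n < rank_K \<mu> p N (Suc n)" if "n \<ge> 1" for n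
    using that rank_K_mono[of n "Suc n"] contra by (auto simp: le_less)
  \<comment> \<open>Strict growth is known only from index 1 on, hence the shift by one.\<close>
  have "n \<le> rank_K \<mu> p N (Suc n)" for n
  proof (induction n)
    case (Suc n)
    then show ?case using less[of "Suc n"] by simp
  qed simp
  from this[of "Suc (card (measure_support \<mu>))"] show False
    using rank_K_le_card_support[OF assms] by (meson not_less_eq_eq order_trans)
qed

section \<open>Equal consecutive ranks force finite support\<close>

text \<open>If the span of the rows stops growing at \<open>n\<close>, it is stable under multiplication by the
  coordinate \<open>x $ i\<close>, since that raises the degree by one.\<close>

lemma row_shift_in_span:
  assumes "rank_K \<mu> p N n = rank_K \<mu> p N (n + 1)"
    and "j \<in> {1..N}" and "row (\<alpha>, j) \<in> fun_span (row ` hankel_index N n)"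
  shows "row (\<alpha>(i := Suc (\<alpha> i)), j) \<in> fun_span (row ` hankel_index N n)"
proof -
  let ?I = "hankel_index N n :: (('d \<Rightarrow> nat) \<times> nat) set"
  \<comment> \<open>On indices, \<open>sh\<close> is multiplication by \<open>x $ i\<close>: it maps
    degree at most \<open>n\<close> into degree at most \<open>n + 1\<close>.\<close>
  define sh where "sh = (\<lambda>(\<alpha>, j::nat). (\<alpha>(i := Suc (\<alpha> i)), j))"
  have f_sh: "exp_monomial p (sh a) x = x $ i * exp_monomial p a x" for a x
    by (cases a) (simp add: sh_def exp_monomial_def mpower_fun_upd_Suc)
  have inj: "inj sh"
    by (rule injI) (auto simp: sh_def fun_eq_iff split: if_splits)
  have sh_I: "sh ` ?I \<subseteq> hankel_index N (n + 1)"
    by (auto simp: sh_def hankel_index_def mdegree_fun_upd_Suc)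
  note fin = finite_hankel_index[of N n] finite_hankel_index[of N "n + 1"]
  obtain c where c: "AE x in \<mu>. exp_monomial p (\<alpha>, j) x = (\<Sum>a\<in>?I. c a * exp_monomial p a x)"
    using assms(2,3) row_in_span_iff[OF finite_hankel_index hankel_index_subset, of "(\<alpha>, j)" n]
    by auto
  \<comment> \<open>Multiplying the relation by \<open>x $ i\<close> shifts every index; injectivity
    of \<open>sh\<close> lets each coefficient be recovered through \<open>inv sh\<close>.\<close>
  have "AE x in \<mu>. exp_monomial p (sh (\<alpha>, j)) x = (\<Sum>b\<in>sh ` ?I. c (inv sh b) * exp_monomial p b x)"
    using c
  proof eventually_elim
    case (elim x)
    have "(\<Sum>b\<in>sh ` ?I. c (inv sh b) * exp_monomial p b x) = (\<Sum>a\<in>?I. c a * exp_monomial p (sh a) x)"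
      using inj by (subst sum.reindex) (auto intro: inj_on_subset simp: inv_f_f)
    with elim show ?case by (simp add: f_sh sum_distrib_left mult_ac)
  qed
  then have "row (sh (\<alpha>, j)) \<in> fun_span (row ` sh ` ?I)"
    using assms(2) fin sh_I hankel_index_subset[of "n + 1"]
    by (subst row_in_span_iff) (auto simp: sh_def)
  also have "\<dots> \<subseteq> fun_span (row ` hankel_index N (n + 1))"
    using sh_I by (intro real_fun.span_mono image_mono)
  \<comment> \<open>This is where the equality of ranks enters: nested spans of equal finite
    dimension coincide.\<close>
  also have "\<dots> = fun_span (row ` ?I)"
    using assms(1) fin hankel_index_mono[of n "n + 1"] unfolding rank_K_eq_dim_rows
    by (intro real_fun.span_eq_if_dim_eq_finite[symmetric] image_mono) auto
  finally show ?thesis by (simp add: sh_def)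
qed

text \<open>The rows of \<open>x $ i ^ k * exp (- (p 1 \<bullet> x))\<close> for all
  \<open>k\<close> lie in one finite-dimensional span, so some row depends on the earlier ones.
  Cancelling the exponential in the resulting relation leaves a polynomial in \<open>x $ i\<close>
  alone.\<close>

lemma AE_component_in_finite:
  assumes "rank_K \<mu> p N n = rank_K \<mu> p N (n + 1)"
  shows "\<exists>R. finite R \<and> (AE x in \<mu>. x $ i \<in> R)"
proof -
  define b where "b k = ((\<lambda>_. 0)(i := k), 1::nat)" for k :: nat
  have "row (b k) \<in> fun_span (row ` hankel_index N n)" for k
  proof (induction k)
    case 0
    have "b 0 \<in> hankel_index N n"
      using N_pos by (simp add: b_def hankel_index_def mdegree_def)
    then show ?case by (intro real_fun.span_base imageI)
  next
    case (Suc k)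
    then show ?case
      using row_shift_in_span[OF assms, of 1 "(\<lambda>_. 0)(i := k)" i] N_pos by (simp add: b_def)
  qed
  then obtain m where m: "row (b m) \<in> fun_span ((\<lambda>k. row (b k)) ` {..<m})"
    using real_fun.ex_mem_span_previous[of "row ` hankel_index N n" "\<lambda>k. row (b k)"] finite_hankel_index
    by blast
  have b_index: "b k \<in> UNIV \<times> {1..N}" for k
    using N_pos by (simp add: b_def)
  have f_b: "exp_monomial p (b k) x = x $ i ^ k * exp (- (p 1 \<bullet> x))" for k x
  proof -
    have "(\<Prod>j\<in>UNIV - {i}. (x $ j) ^ ((\<lambda>_. 0)(i := k)) j) = 1"
      by (rule prod.neutral) auto
    then show ?thesis
      by (simp add: b_def exp_monomial_def mpower_def prod.remove[of UNIV i])
  qed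
  have inj: "inj b"
    by (rule injI) (auto simp: b_def dest: fun_cong[of _ _ i])
  have "row (b m) \<in> fun_span (row ` b ` {..<m})"
    using m by (simp add: image_image)
  then obtain c where
    "AE x in \<mu>. exp_monomial p (b m) x = (\<Sum>a\<in>b ` {..<m}. c a * exp_monomial p a x)"
    using row_in_span_iff[of "b ` {..<m}" "b m"] b_index by (auto simp del: One_nat_def)
  \<comment> \<open>The top coefficient -1 makes the polynomial nonzero, also for
    \<open>m = 0\<close>, so it has finitely many roots.\<close>
  then have AE: "AE x in \<mu>. (\<Sum>k\<le>m. (if k = m then - 1 else c (b k)) * x $ i ^ k) = 0"
  proof eventually_elim
    case (elim x)
    have "(\<Sum>a\<in>b ` {..<m}. c a * exp_monomial p a x) = (\<Sum>k<m. c (b k) * x $ i ^ k) * exp (- (p 1 \<bullet> x))"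
      using inj by (subst sum.reindex) (auto intro: inj_on_subset simp: f_b sum_distrib_right mult.assoc)
    with elim have "x $ i ^ m = (\<Sum>k<m. c (b k) * x $ i ^ k)"
      by (simp add: f_b)
    then show ?case
      by (simp add: lessThan_Suc_atMost[symmetric])
  qed
  have "finite {z. (\<Sum>k\<le>m. (if k = m then - 1 else c (b k)) * z ^ k) = (0::real)}"
    by (rule polyfun_roots_finite[of _ m]) auto
  with AE show ?thesis by (intro exI conjI) auto
qed

text \<open>The finite root sets of the separate coordinates form a finite grid \<open>F\<close>;
  being finite it is closed, so it contains the support as soon as it carries the measure.\<close>

lemma finite_support_if_rank_K_eq:
  assumes "rank_K \<mu> p N n = rank_K \<mu> p N (n + 1)"
  shows "finite (measure_support \<mu>)"
proof -
  obtain R where R: "\<And>i. finite (R i)" "\<And>i. AE x in \<mu>. x $ i \<in> R i"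
    using AE_component_in_finite[OF assms] by metis
  define F where "F = {x :: real ^ 'd. \<forall>i. x $ i \<in> R i}"
  have "F \<subseteq> vec_lambda ` PiE UNIV R"
  proof
    fix x assume "x \<in> F"
    then show "x \<in> vec_lambda ` PiE UNIV R"
      by (intro image_eqI[of _ _ "vec_nth x"]) (auto simp: F_def)
  qed
  then have fin: "finite F"
    by (rule finite_subset) (auto intro!: finite_imageI finite_PiE R(1))
  have "AE x in \<mu>. x \<in> F"
    using R(2) by (simp add: F_def AE_all_countable)
  then show ?thesis
    using measure_support_subset_closed[OF borel finite_imp_closed[OF fin]] fin finite_subset by blast
qed

end

theorem theorem5p5:
  fixes \<Gamma> :: "(real ^ 'd::finite) set"
    and \<mu> :: "(real ^ 'd) measure"
    and p :: "nat \<Rightarrow> real ^ 'd"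
    and N :: nat
  assumes "closed \<Gamma>" and "convex \<Gamma>" and "cone \<Gamma>"
    and "contains_no_line \<Gamma>" and "interior \<Gamma> \<noteq> {}"
    and "borel_measure_on (dual_cone \<Gamma>) \<mu>"
    and "moderate_growth \<Gamma> \<mu>"
    and "N \<ge> 1" and "\<forall>j\<in>{1..N}. p j \<in> interior \<Gamma>"
  shows "finite (measure_support \<mu>) \<longleftrightarrow>
    (\<exists>n::nat. n \<ge> 1 \<and> rank_K \<mu> p N n = rank_K \<mu> p N (n + 1))"
proof -
  interpret moderate_growth_measure \<Gamma> \<mu> p N
    using assms by unfold_locales
  show ?thesis
    using rank_K_stabilises finite_support_if_rank_K_eq by blast
qed

end
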